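(* Let $G_1$ and $G_2$ be vertex-disjoint graphs on $n_1$ and $n_2$ vertices respectively. Then, as identities of rational functions in $x$: (a) $$\begin{aligned} f_{Q(G_1\underset{=}{\vee}G_2)}(x)&=\det\big((x-n_1)I_{n_2}-Q(G_2)\big)\,\det\big((x-n_1+1)I_{n_1}+D(G_1)\big)\\ &\cdot\det\Big((x-n_1-n_2+1)I_{n_1}-Q(G_1)+D(G_1)-A(\overline{G_1})\big((x-n_1+1)I_{n_1}+D(G_1)\big)^{-1}A(\overline{G_1})\Big)\\ &\cdot\Big[1-\Gamma_{Q(G_2)}(x-n_1)\,\Gamma_{Q(G_1)-D(G_1)+A(\overline{G_1})((x-n_1+1)I_{n_1}+D(G_1))^{-1}A(\overline{G_1})}(x-n_1-n_2+1)\Big].\end{aligned}$$ (b) $$\begin{aligned} f_{Q(G_1\veebar G_2)}(x)&=\det\big((x-n_1)I_{n_2}-Q(G_2)\big)\,\det\big(xI_{n_1}-D(G_1)\big)\\ &\cdot\det\Big((x-n_2)I_{n_1}-Q(G_1)-D(G_1)-A(G_1)\big(xI_{n_1}-D(G_1)\big)^{-1}A(G_1)\Big)\\ &\cdot\Big[1-\Gamma_{Q(G_2)}(x-n_1)\,\Gamma_{Q(G_1)+D(G_1)+A(G_1)(xI_{n_1}-D(G_1))^{-1}A(G_1)}(x-n_2)\Big].\end{aligned}$$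
   Context: Graphs are finite, undirected and simple. $A(G)$ is the adjacency matrix, $D(G)$ the diagonal matrix of vertex degrees, $Q(G)=D(G)+A(G)$ the signless Laplacian matrix, and $\overline{G}$ the complement of $G$. For an $n\times n$ matrix $M$, $f_M(x)=\det(xI_n-M)$, and the coronal of $M$ is $\Gamma_M(y)=\mathbf 1_n^T(yI_n-M)^{-1}\mathbf 1_n$, where $\mathbf 1_n$ is the all-ones column. When the entries of $M$ depend on $x$, $\Gamma_M(x-c)$ means $\mathbf 1_n^T((x-c)I_n-M)^{-1}\mathbf 1_n$ with that same $x$. Let $V(G_1)=\{u_1,\dots,u_{n_1}\}$. The join $G_1\vee G_2$ is the disjoint union of $G_1$ and $G_2$ together with all edges between $V(G_1)$ and $V(G_2)$. The NS (Neighbors Splitting) join $G_1\veebar G_2$ is obtained from $G_1\vee G_2$ by adding new vertices $u_1',\dots,u_{n_1}'$ and joining $u_i'$ to $u_j$ if and only if $u_iu_j\in E(G_1)$. The NNS (Non Neighbors Splitting) join $G_1\underset{=}{\vee}G_2$ is obtained from $G_1\vee G_2$ by adding new vertices $u_1',\dots,u_{n_1}'$ and joining $u_i'$ to $u_j$ if and only if $i\ne j$ and $u_iu_j\notin E(G_1)$. *)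

theory Defs
  imports
    "Jordan_Normal_Form.Char_Poly"
    "Jordan_Normal_Form.Gauss_Jordan_Elimination"
    "Graph_Theory.Pair_Digraph"
begin

text \<open>
  A finite simple undirected graph is a \<^locale>\<open>pair_graph\<close>: a finite vertex set with a symmetric,
  irreflexive set of ordered pairs, so that an edge \<open>uv\<close> appears as both \<open>(u, v)\<close> and \<open>(v, u)\<close>.
\<close>

definition complement :: "'v pair_pre_digraph \<Rightarrow> 'v pair_pre_digraph" where
  "complement G = \<lparr>pverts = pverts G,
     parcs = {(u, v). u \<in> pverts G \<and> v \<in> pverts G \<and> u \<noteq> v \<and> (u, v) \<notin> parcs G}\<rparr>"

text \<open>Meant for vertex-disjoint graphs.\<close>

definition graph_join ::
  "'v pair_pre_digraph \<Rightarrow> 'v pair_pre_digraph \<Rightarrow> 'v pair_pre_digraph" where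
  "graph_join G1 G2 = \<lparr>pverts = pverts G1 \<union> pverts G2,
     parcs = parcs G1 \<union> parcs G2 \<union> pverts G1 \<times> pverts G2 \<union> pverts G2 \<times> pverts G1\<rparr>"

text \<open>
  In the splitting joins \<open>Inl w\<close> is the vertex \<open>w\<close> of the join, and \<open>Inr u\<close> is the new vertex \<open>u'\<close>
  belonging to a vertex \<open>u\<close> of \<open>G1\<close>.
\<close>

definition ns_join ::
  "'v pair_pre_digraph \<Rightarrow> 'v pair_pre_digraph \<Rightarrow> ('v + 'v) pair_pre_digraph" where
  "ns_join G1 G2 = \<lparr>pverts = Inl ` pverts (graph_join G1 G2) \<union> Inr ` pverts G1,
     parcs = {(Inl v, Inl w) | v w. (v, w) \<in> parcs (graph_join G1 G2)}
       \<union> {(Inr u, Inl w) | u w. u \<in> pverts G1 \<and> w \<in> pverts G1 \<and> (u, w) \<in> parcs G1}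
       \<union> {(Inl w, Inr u) | u w. u \<in> pverts G1 \<and> w \<in> pverts G1 \<and> (u, w) \<in> parcs G1}\<rparr>"

definition nns_join ::
  "'v pair_pre_digraph \<Rightarrow> 'v pair_pre_digraph \<Rightarrow> ('v + 'v) pair_pre_digraph" where
  "nns_join G1 G2 = \<lparr>pverts = Inl ` pverts (graph_join G1 G2) \<union> Inr ` pverts G1,
     parcs = {(Inl v, Inl w) | v w. (v, w) \<in> parcs (graph_join G1 G2)}
       \<union> {(Inr u, Inl w) | u w. u \<in> pverts G1 \<and> w \<in> pverts G1 \<and> u \<noteq> w \<and> (u, w) \<notin> parcs G1}
       \<union> {(Inl w, Inr u) | u w. u \<in> pverts G1 \<and> w \<in> pverts G1 \<and> u \<noteq> w \<and> (u, w) \<notin> parcs G1}\<rparr>"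

lemma pair_graphI:
  assumes "finite (pverts G)" and "parcs G \<subseteq> pverts G \<times> pverts G"
    and "sym (parcs G)" and "irrefl (parcs G)"
  shows "pair_graph G"
proof
  show "finite (parcs G)" using assms(1,2) by (meson finite_SigmaI finite_subset)
qed (use assms in \<open>auto simp: symmetric_def irrefl_def\<close>)

lemma pair_graphD:
  assumes "pair_graph G"
  shows "finite (pverts G)" and "parcs G \<subseteq> pverts G \<times> pverts G"
    and "sym (parcs G)" and "irrefl (parcs G)"
proof -
  interpret pair_graph G by fact
  show "finite (pverts G)" by simp
  show "parcs G \<subseteq> pverts G \<times> pverts G"
    using arc_fst_in_verts arc_snd_in_verts by (force simp: mem_Times_iff)
  show "sym (parcs G)" using pair_sym_arcs by (simp add: symmetric_def)
  show "irrefl (parcs G)" using pair_no_loops by (force simp: irrefl_def)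
qed

lemma pair_graph_complement:
  assumes "pair_graph G"
  shows "pair_graph (complement G)"
  using pair_graphD[OF assms]
  by (intro pair_graphI) (auto simp: complement_def sym_def irrefl_def)

lemma pair_graph_graph_join:
  assumes "pair_graph G1" and "pair_graph G2" and "pverts G1 \<inter> pverts G2 = {}"
  shows "pair_graph (graph_join G1 G2)"
  using pair_graphD[OF assms(1)] pair_graphD[OF assms(2)] assms(3)
  by (intro pair_graphI) (auto simp: graph_join_def sym_def irrefl_def)

lemma pair_graph_ns_join:
  assumes "pair_graph G1" and "pair_graph G2" and "pverts G1 \<inter> pverts G2 = {}"
  shows "pair_graph (ns_join G1 G2)"
proof -
  have "pverts G1 \<subseteq> pverts (graph_join G1 G2)" by (simp add: graph_join_def)
  then show ?thesis
    using pair_graphD[OF pair_graph_graph_join[OF assms]] pair_graphD[OF assms(1)]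
    by (intro pair_graphI) (auto simp: ns_join_def sym_def irrefl_def)
qed

lemma pair_graph_nns_join:
  assumes "pair_graph G1" and "pair_graph G2" and "pverts G1 \<inter> pverts G2 = {}"
  shows "pair_graph (nns_join G1 G2)"
proof -
  have "pverts G1 \<subseteq> pverts (graph_join G1 G2)" by (simp add: graph_join_def)
  then show ?thesis
    using pair_graphD[OF pair_graph_graph_join[OF assms]] pair_graphD[OF assms(1)]
    by (intro pair_graphI) (auto simp: nns_join_def sym_def irrefl_def)
qed

text \<open>
  The matrices of a graph are taken with respect to a list of its vertices, which fixes the order of
  rows and columns.
\<close>

definition vertex_enum :: "'v pair_pre_digraph \<Rightarrow> 'v list \<Rightarrow> bool" where
  "vertex_enum G us \<longleftrightarrow> distinct us \<and> set us = pverts G"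

definition adjacency_mat :: "'v pair_pre_digraph \<Rightarrow> 'v list \<Rightarrow> real mat" where
  "adjacency_mat G us = mat (length us) (length us)
     (\<lambda>(i, j). if (us ! i, us ! j) \<in> parcs G then 1 else 0)"

text \<open>In a symmetric loop-free digraph the out-degree is the degree of the undirected graph.\<close>

definition deg_mat :: "'v pair_pre_digraph \<Rightarrow> 'v list \<Rightarrow> real mat" where
  "deg_mat G us = mat (length us) (length us)
     (\<lambda>(i, j). if i = j then real (out_degree (with_proj G) (us ! i)) else 0)"

definition signless_laplacian :: "'v pair_pre_digraph \<Rightarrow> 'v list \<Rightarrow> real mat" where
  "signless_laplacian G us = deg_mat G us + adjacency_mat G us"

text \<open>
  The field of rational functions in \<open>x\<close> over the reals is \<^typ>\<open>real poly fract\<close>;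
  \<open>ratfun_mat\<close> views a real matrix as a matrix of constant rational functions.
\<close>

definition ratfun_x :: "real poly fract" where
  "ratfun_x = to_fract [:0, 1:]"

definition ratfun_mat :: "real mat \<Rightarrow> real poly fract mat" where
  "ratfun_mat M = map_mat (\<lambda>c. to_fract [:c:]) M"

text \<open>Unspecified for a singular matrix.\<close>

definition mat_inv :: "'a :: field mat \<Rightarrow> 'a mat" where
  "mat_inv M = the (mat_inverse M)"

text \<open>
  The entries of \<open>M\<close> and the argument \<open>y\<close> lie in one field. For the field of rational functions,
  \<open>coronal M (ratfun_x - c)\<close> therefore uses in \<open>y\<close> the same \<open>x\<close> that may occur in the entries of \<open>M\<close>.
\<close>

definition coronal :: "'a :: field mat \<Rightarrow> 'a \<Rightarrow> 'a" where
  "coronal M y = (let n = dim_row M; ones = vec n (\<lambda>_. 1) in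
     ones \<bullet> (mat_inv (y \<cdot>\<^sub>m 1\<^sub>m n - M) *\<^sub>v ones))"

end

theory Submission
  imports Defs
begin

text \<open>
  Order the vertices of a splitting join as \<open>G1\<close>, \<open>G2\<close>, copies. Eliminating the block of the
  copies from \<open>x I - Q\<close> by a Schur complement only changes the \<open>G1\<close> block, and eliminating the
  \<open>G2\<close> block then subtracts a multiple of the all-ones matrix from it, the factor being the coronal
  of \<open>Q(G2)\<close>. Since the all-ones matrix has rank one, this produces the other coronal. The Schur
  complement to be inverted is nonsingular because, up to a nonzero factor, its determinant is the
  characteristic polynomial of the real matrix consisting of the \<open>G1\<close> and copy blocks.
\<close>

section \<open>Schur complements\<close>

text \<open>A nonzero determinant makes the matrix a unit, so \<open>mat_inverse\<close> returns
  \<open>Some\<close> and the \<open>the\<close> in \<open>mat_inv\<close> is harmless. All later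
  invertibility arguments therefore reduce to nonvanishing determinants.\<close>

lemma mat_inv:
  fixes A :: "'a :: field mat"
  assumes "A \<in> carrier_mat n n" and "det A \<noteq> 0"
  shows "A * mat_inv A = 1\<^sub>m n" and "mat_inv A * A = 1\<^sub>m n" and "mat_inv A \<in> carrier_mat n n"
proof -
  have "mat_inverse A \<noteq> None"
    \<comment> \<open>The \<open>"()"\<close> instantiates the dummy extension parameter of the
      matrix ring whose units are meant.\<close>
    using mat_inverse(1)[OF assms(1), of "()"] det_non_zero_imp_unit[OF assms, of "()"] by blast
  then have "mat_inverse A = Some (mat_inv A)"
    by (auto simp: mat_inv_def)
  from mat_inverse(2)[OF assms(1) this]
  show "A * mat_inv A = 1\<^sub>m n" "mat_inv A * A = 1\<^sub>m n" "mat_inv A \<in> carrier_mat n n"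
    by auto
qed

lemma mat_inv_one: "mat_inv (1\<^sub>m n) = (1\<^sub>m n :: 'a :: field mat)"
  using mat_inv[of "1\<^sub>m n :: 'a mat" n] by simp

lemma mult_assoc_inv_cancel:
  fixes D :: "'a :: field mat"
  assumes D: "D \<in> carrier_mat m m" and det: "det D \<noteq> 0" and C: "C \<in> carrier_mat m n"
  shows "D * (mat_inv D * C) = C"
proof -
  note D' = mat_inv[OF D det]
  have "D * (mat_inv D * C) = (D * mat_inv D) * C"
    using D D'(3) C by (simp add: assoc_mult_mat)
  with D'(1) C show ?thesis by simp
qed

text \<open>Block column operations, encoded by the unitriangular \<open>L\<close>, clear the lower
  left block; what remains is block upper triangular.\<close>

lemma det_four_block_mat_schur_lower:
  fixes A :: "'a :: field mat"
  assumes A: "A \<in> carrier_mat n n" and B: "B \<in> carrier_mat n m"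
    and C: "C \<in> carrier_mat m n" and D: "D \<in> carrier_mat m m" and det: "det D \<noteq> 0"
  shows "det (four_block_mat A B C D) = det D * det (A - B * mat_inv D * C)"
proof -
  note D' = mat_inv[OF D det]
  define L where "L = four_block_mat (1\<^sub>m n) (0\<^sub>m n m) (- (mat_inv D * C)) (1\<^sub>m m)"
  have DC: "- (mat_inv D * C) \<in> carrier_mat m n" using D' C by auto
  have L: "L \<in> carrier_mat (n + m) (n + m)" unfolding L_def by simp
  have detL: "det L = 1"
    unfolding L_def by (subst det_four_block_mat_upper_right_zero[OF _ refl DC]) auto
  have eqA: "A + - (B * (mat_inv D * C)) = A - B * mat_inv D * C"
    using A B D'(3) C by (simp add: assoc_mult_mat[of B n m "mat_inv D" m C n] add_uminus_minus_mat)
  have eq1: "A * 1\<^sub>m n + B * (- (mat_inv D * C)) = A - B * mat_inv D * C"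
    using A B D'(3) C eqA by simp
  have eq3: "C * 1\<^sub>m n + D * (- (mat_inv D * C)) = 0\<^sub>m m n"
    using C D D'(3) mult_assoc_inv_cancel[OF D det C] by (simp add: add_uminus_minus_mat)
  have "four_block_mat A B C D * L =
    four_block_mat (A - B * mat_inv D * C) B (0\<^sub>m m n) D"
    unfolding L_def
    using mult_four_block_mat[OF A B C D one_carrier_mat zero_carrier_mat DC one_carrier_mat]
      A B C D eq1 eq3 by simp
  moreover have "det (four_block_mat (A - B * mat_inv D * C) B (0\<^sub>m m n) D) =
      det (A - B * mat_inv D * C) * det D"
    using A B C D D' by (intro det_four_block_mat_lower_left_zero) auto
  ultimately show ?thesis
    using det_mult[OF four_block_carrier_mat[OF A D] L, of B C] detL by (simp add: mult.commute)
qed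

text \<open>The mirror image: with \<open>A\<close> as pivot, the upper right block is cleared
  instead.\<close>

lemma det_four_block_mat_schur_upper:
  fixes A :: "'a :: field mat"
  assumes A: "A \<in> carrier_mat n n" and B: "B \<in> carrier_mat n m"
    and C: "C \<in> carrier_mat m n" and D: "D \<in> carrier_mat m m" and det: "det A \<noteq> 0"
  shows "det (four_block_mat A B C D) = det A * det (D - C * mat_inv A * B)"
proof -
  note A' = mat_inv[OF A det]
  define L where "L = four_block_mat (1\<^sub>m n) (- (mat_inv A * B)) (0\<^sub>m m n) (1\<^sub>m m)"
  have AB: "- (mat_inv A * B) \<in> carrier_mat n m" using A' B by auto
  have L: "L \<in> carrier_mat (n + m) (n + m)" unfolding L_def by simp
  have detL: "det L = 1"
    unfolding L_def by (subst det_four_block_mat_lower_left_zero[OF _ AB refl]) auto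
  have "- (C * (mat_inv A * B)) + D = D - C * mat_inv A * B"
    using C A'(3) B D
    by (simp add: assoc_mult_mat[of C m n "mat_inv A" n B m])
       (intro eq_matI, auto)
  then have eq1: "C * (- (mat_inv A * B)) + D * 1\<^sub>m m = D - C * mat_inv A * B"
    using C A'(3) B D by simp
  have eq3: "A * (- (mat_inv A * B)) + B * 1\<^sub>m m = 0\<^sub>m n m"
    using A B A'(3) mult_assoc_inv_cancel[OF A det B] by simp
  have "four_block_mat A B C D * L =
    four_block_mat A (0\<^sub>m n m) C (D - C * mat_inv A * B)"
    unfolding L_def
    using mult_four_block_mat[OF A B C D one_carrier_mat AB zero_carrier_mat one_carrier_mat]
      A B C D eq1 eq3 by simp
  moreover have "det (four_block_mat A (0\<^sub>m n m) C (D - C * mat_inv A * B)) =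
      det A * det (D - C * mat_inv A * B)"
    using A B C D A' by (intro det_four_block_mat_upper_right_zero) auto
  ultimately show ?thesis
    using det_mult[OF four_block_carrier_mat[OF A D] L, of B C] detL by simp
qed

text \<open>The matrix determinant lemma: border \<open>A\<close> by the column \<open>u\<close>,
  the row \<open>v\<close> and a corner 1, then evaluate by both Schur formulas. Pivoting on the
  corner gives one side, pivoting on \<open>A\<close> the other.\<close>

lemma det_minus_rank_one:
  fixes A :: "'a :: field mat"
  assumes A: "A \<in> carrier_mat n n" and u: "u \<in> carrier_mat n 1" and v: "v \<in> carrier_mat 1 n"
    and det: "det A \<noteq> 0"
  shows "det (A - u * v) = det A * (1 - (v * mat_inv A * u) $$ (0, 0))"
proof -
  have one: "1\<^sub>m 1 \<in> carrier_mat 1 (1 :: nat)" by simp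
  have "det (A - u * v) = det (four_block_mat A u v (1\<^sub>m 1))"
    using det_four_block_mat_schur_lower[OF A u v one] u by (simp add: mat_inv_one)
  also have "\<dots> = det A * det (1\<^sub>m 1 - v * mat_inv A * u)"
    by (rule det_four_block_mat_schur_upper[OF A u v one det])
  also have "det (1\<^sub>m 1 - v * mat_inv A * u) = 1 - (v * mat_inv A * u) $$ (0, 0)"
    using u v by (subst det_single) auto
  finally show ?thesis .
qed

section \<open>Coronals and bordered matrices\<close>

text \<open>Rectangular, so that it serves both as the block of the edges between \<open>G1\<close>
  and \<open>G2\<close> and as the row and column of ones in a coronal.\<close>

definition ones_mat :: "nat \<Rightarrow> nat \<Rightarrow> 'a :: one mat" where
  "ones_mat n m = mat n m (\<lambda>_. 1)"

lemma ones_mat_carrier [simp]: "ones_mat n m \<in> carrier_mat n m"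
  and ones_mat_dim [simp]: "dim_row (ones_mat n m) = n" "dim_col (ones_mat n m) = m"
  and ones_mat_index [simp]: "i < n \<Longrightarrow> j < m \<Longrightarrow> ones_mat n m $$ (i, j) = 1"
  by (auto simp: ones_mat_def)

text \<open>Brings the coronal into the shape in which \<open>det_minus_rank_one\<close> produces
  it, a 1 by 1 matrix product.\<close>

lemma coronal_eq_ones_mat:
  fixes M :: "'a :: field mat"
  assumes M: "M \<in> carrier_mat n n" and det: "det (y \<cdot>\<^sub>m 1\<^sub>m n - M) \<noteq> 0"
  shows "coronal M y =
    (ones_mat 1 n * mat_inv (y \<cdot>\<^sub>m 1\<^sub>m n - M) * ones_mat n 1) $$ (0, 0)"
proof -
  have inv: "mat_inv (y \<cdot>\<^sub>m 1\<^sub>m n - M) \<in> carrier_mat n n"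
    by (rule mat_inv[OF _ det]) (use M in auto)
  have "ones_mat 1 n * mat_inv (y \<cdot>\<^sub>m 1\<^sub>m n - M) * ones_mat n 1 =
      ones_mat 1 n * (mat_inv (y \<cdot>\<^sub>m 1\<^sub>m n - M) * ones_mat n 1)"
    by (rule assoc_mult_mat[OF _ inv]) auto
  moreover have "row (ones_mat 1 n) 0 = vec n (\<lambda>_. 1 :: 'a)"
    by (rule eq_vecI) (simp_all add: row_def)
  moreover have "col (mat_inv (y \<cdot>\<^sub>m 1\<^sub>m n - M) * ones_mat n 1) 0 =
      mat_inv (y \<cdot>\<^sub>m 1\<^sub>m n - M) *\<^sub>v vec n (\<lambda>_. 1)"
  proof -
    have "col (ones_mat n 1) 0 = vec n (\<lambda>_. 1 :: 'a)"
      by (rule eq_vecI) (simp_all add: col_def)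
    then show ?thesis using inv by (intro eq_vecI) auto
  qed
  ultimately show ?thesis using M inv by (simp add: coronal_def Let_def)
qed

text \<open>Beyond the dimension, a coronal sees only the matrix that is inverted, so multiples of
  the identity may move between \<open>M\<close> and the argument.\<close>

lemma coronal_cong:
  fixes M N :: "'a :: field mat"
  assumes "M \<in> carrier_mat n n" and "N \<in> carrier_mat n n"
    and "y \<cdot>\<^sub>m 1\<^sub>m n - M = z \<cdot>\<^sub>m 1\<^sub>m n - N"
  shows "coronal M y = coronal N z"
  using assms by (auto simp: coronal_def Let_def)

section \<open>Zero-padded coupling blocks and the determinant of the bordered matrix\<close>

definition pad_rows :: "nat \<Rightarrow> 'a :: zero mat \<Rightarrow> 'a mat" where
  "pad_rows m E = mat (dim_row E + m) (dim_col E) (\<lambda>(i, j). if i < dim_row E then E $$ (i, j) else 0)"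

definition pad_cols :: "nat \<Rightarrow> 'a :: zero mat \<Rightarrow> 'a mat" where
  "pad_cols m E = mat (dim_row E) (dim_col E + m) (\<lambda>(i, j). if j < dim_col E then E $$ (i, j) else 0)"

lemma pad_rows_carrier: "E \<in> carrier_mat n k \<Longrightarrow> pad_rows m E \<in> carrier_mat (n + m) k"
  and pad_cols_carrier: "E \<in> carrier_mat n k \<Longrightarrow> pad_cols m E \<in> carrier_mat n (k + m)"
  by (auto simp: pad_rows_def pad_cols_def)

text \<open>The zero padding expresses that copies have no neighbours in \<open>G2\<close>. Hence
  the correction from eliminating the copies stays in the corner belonging to
  \<open>G1\<close>.\<close>

lemma pad_rows_mult_pad_cols:
  fixes E :: "'a :: comm_ring_1 mat"
  assumes E: "E \<in> carrier_mat n n" and Z: "Z \<in> carrier_mat n n" and F: "F \<in> carrier_mat n n"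
  shows "pad_rows m E * Z * pad_cols m F =
    four_block_mat (E * Z * F) (0\<^sub>m n m) (0\<^sub>m m n) (0\<^sub>m m m)"
proof -
  have rows: "row (pad_rows m E) i = (if i < n then row E i else 0\<^sub>v n)" if "i < n + m" for i
    using that E by (auto simp: pad_rows_def)
  have cols: "col (pad_cols m F) j = (if j < n then col F j else 0\<^sub>v n)" if "j < n + m" for j
    using that F by (auto simp: pad_cols_def)
  have dims: "dim_row (pad_rows m E) = n + m" "dim_col (pad_rows m E) = n"
    "dim_row (pad_cols m F) = n" "dim_col (pad_cols m F) = n + m"
    using E F by (auto simp: pad_rows_def pad_cols_def)
  have rows': "row (pad_rows m E * Z) i = (if i < n then row (E * Z) i else 0\<^sub>v n)"
    if "i < n + m" for i
    using that E Z by (intro eq_vecI) (auto simp: rows dims)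
  show ?thesis
    by (rule eq_matI) (use E Z F in \<open>auto simp: rows' cols dims simp del: assoc_mult_mat\<close>)
qed

text \<open>Pivoting on \<open>P\<close> replaces \<open>X\<close> by the Schur complement
  \<open>S\<close>; pivoting on \<open>V\<close> then subtracts a constant multiple of the all-ones
  matrix from \<open>S\<close>, which \<open>det_minus_rank_one\<close> evaluates.\<close>

lemma det_block_ones:
  fixes X P V E :: "'a :: field mat"
  assumes X: "X \<in> carrier_mat n n" and V: "V \<in> carrier_mat m m"
    and E: "E \<in> carrier_mat n n" and P: "P \<in> carrier_mat n n"
    and detP: "det P \<noteq> 0" and detV: "det V \<noteq> 0"
    and detS: "det (X - E * mat_inv P * E) \<noteq> 0"
  shows "det (four_block_mat (four_block_mat X (- ones_mat n m) (- ones_mat m n) V)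
      (pad_rows m (- E)) (pad_cols m (- E)) P) =
    det V * det P * det (X - E * mat_inv P * E) *
      (1 - (ones_mat 1 m * mat_inv V * ones_mat m 1) $$ (0, 0) *
        (ones_mat 1 n * mat_inv (X - E * mat_inv P * E) * ones_mat n 1) $$ (0, 0))"
proof -
  define S where "S = X - E * mat_inv P * E"
  define c where "c = (ones_mat 1 m * mat_inv V * ones_mat m 1) $$ (0, 0)"
  note P' = mat_inv[OF P detP] and V' = mat_inv[OF V detV]
  have S: "S \<in> carrier_mat n n" using X E P' by (auto simp: S_def)
  have detS': "det S \<noteq> 0" using detS by (simp add: S_def)
  note S' = mat_inv[OF S detS']
  let ?J = "four_block_mat X (- ones_mat n m) (- ones_mat m n) V"
  have "- E * mat_inv P * - E = E * mat_inv P * E"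
    using E P'(3) by simp
  then have "?J - pad_rows m (- E) * mat_inv P * pad_cols m (- E) =
      four_block_mat S (- ones_mat n m) (- ones_mat m n) V"
    using X E P'(3) V by (subst pad_rows_mult_pad_cols[of _ n]) (auto simp: S_def)
  then have "det (four_block_mat ?J (pad_rows m (- E)) (pad_cols m (- E)) P) =
      det P * det (four_block_mat S (- ones_mat n m) (- ones_mat m n) V)"
    using X V E P detP
    by (subst det_four_block_mat_schur_lower[of _ "n + m" _ n])
       (auto simp: pad_rows_carrier pad_cols_carrier)
  also have "det (four_block_mat S (- ones_mat n m) (- ones_mat m n) V) =
      det V * det (S - (- ones_mat n m) * mat_inv V * (- ones_mat m n))"
    using S V detV by (intro det_four_block_mat_schur_lower) auto
  \<comment> \<open>Every entry of this product is \<open>c\<close>, the sum of all entries of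
    \<open>mat_inv V\<close>. Attaching \<open>c\<close> to the column factor exhibits the product
    as column times row.\<close>
  also have "(- ones_mat n m) * mat_inv V * (- ones_mat m n) =
      (c \<cdot>\<^sub>m ones_mat n 1) * ones_mat 1 n"
  proof -
    have "ones_mat n m * mat_inv V * ones_mat m n = (c \<cdot>\<^sub>m ones_mat n 1) * ones_mat 1 n"
    proof (rule eq_matI)
      fix i j assume ij: "i < dim_row ((c \<cdot>\<^sub>m ones_mat n 1) * ones_mat 1 n)"
        "j < dim_col ((c \<cdot>\<^sub>m ones_mat n 1) * ones_mat 1 n)"
      have "row (ones_mat n m * mat_inv V) i = row (ones_mat 1 m * mat_inv V) 0"
        using ij V'(3) by (intro eq_vecI) (auto simp: scalar_prod_def)
      moreover have "col (ones_mat m n) j = (col (ones_mat m 1) 0 :: 'a vec)"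
        using ij by (intro eq_vecI) auto
      ultimately have "(ones_mat n m * mat_inv V * ones_mat m n) $$ (i, j) = c"
        using ij by (simp add: c_def)
      then show "(ones_mat n m * mat_inv V * ones_mat m n) $$ (i, j) =
          ((c \<cdot>\<^sub>m ones_mat n 1) * ones_mat 1 n) $$ (i, j)"
        using ij by (simp add: scalar_prod_def)
    qed auto
    then show ?thesis using V'(3) by simp
  qed
  also have "det (S - (c \<cdot>\<^sub>m ones_mat n 1) * ones_mat 1 n) =
      det S * (1 - (ones_mat 1 n * mat_inv S * (c \<cdot>\<^sub>m ones_mat n 1)) $$ (0, 0))"
    using S detS' by (intro det_minus_rank_one) auto
  also have "ones_mat 1 n * mat_inv S * (c \<cdot>\<^sub>m ones_mat n 1) =
      c \<cdot>\<^sub>m (ones_mat 1 n * mat_inv S * ones_mat n 1)"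
    using S' by (intro mult_smult_distrib) auto
  finally show ?thesis using S'
    by (simp add: S_def c_def ac_simps)
qed

section \<open>Characteristic matrices over the rational functions\<close>

interpretation const_ratfun: comm_ring_hom "\<lambda>c :: real. to_fract [:c:]"
  by unfold_locales (auto simp: pCons_one simp flip: to_fract_add to_fract_mult)

lemma ratfun_mat_carrier [simp]: "ratfun_mat M \<in> carrier_mat n k \<longleftrightarrow> M \<in> carrier_mat n k"
  and ratfun_mat_dim [simp]: "dim_row (ratfun_mat M) = dim_row M" "dim_col (ratfun_mat M) = dim_col M"
  and ratfun_mat_index [simp]:
    "i < dim_row M \<Longrightarrow> j < dim_col M \<Longrightarrow> ratfun_mat M $$ (i, j) = to_fract [:M $$ (i, j):]"
  by (auto simp: ratfun_mat_def)

text \<open>Determinants commute with the ring homomorphism \<open>to_fract\<close>. This carries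
  the characteristic polynomial into the field where Schur complements are available.\<close>

lemma det_ratfun_char:
  assumes M: "M \<in> carrier_mat n n"
  shows "det (ratfun_x \<cdot>\<^sub>m 1\<^sub>m n - ratfun_mat M) = to_fract (char_poly M)"
proof -
  interpret h: comm_ring_hom "to_fract :: real poly \<Rightarrow> _"
    by unfold_locales auto
  have "map_mat to_fract (char_poly_matrix M) = ratfun_x \<cdot>\<^sub>m 1\<^sub>m n - ratfun_mat M"
    using M
    by (intro eq_matI)
       (auto simp: char_poly_matrix_def ratfun_x_def ratfun_mat_def const_ratfun.hom_uminus simp flip: to_fract_diff)
  then show ?thesis by (simp add: char_poly_def h.hom_det[symmetric])
qed

text \<open>A characteristic polynomial is monic, hence nonzero, and stays nonzero in the fraction
  field.\<close>

lemma det_ratfun_char_nonzero: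
  assumes M: "M \<in> carrier_mat n n"
  shows "det (ratfun_x \<cdot>\<^sub>m 1\<^sub>m n - ratfun_mat M) \<noteq> 0"
  using degree_monic_char_poly[OF M] by (auto simp: det_ratfun_char[OF M])

text \<open>\<open>det_block_ones\<close> applied to the characteristic matrix; the work lies in its
  three nonvanishing conditions. Two of them concern characteristic matrices of the real matrices
  \<open>B\<close> and \<open>P\<close>.\<close>

lemma char_poly_block_ones:
  assumes A: "A \<in> carrier_mat n n" and B: "B \<in> carrier_mat m m"
    and E: "E \<in> carrier_mat n n" and P: "P \<in> carrier_mat n n"
  defines "R \<equiv> ratfun_mat E * mat_inv (ratfun_x \<cdot>\<^sub>m 1\<^sub>m n - ratfun_mat P) * ratfun_mat E"
  shows "to_fract (char_poly (four_block_mat (four_block_mat A (ones_mat n m) (ones_mat m n) B)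
      (pad_rows m E) (pad_cols m E) P)) =
    det (ratfun_x \<cdot>\<^sub>m 1\<^sub>m m - ratfun_mat B) * det (ratfun_x \<cdot>\<^sub>m 1\<^sub>m n - ratfun_mat P) *
    det (ratfun_x \<cdot>\<^sub>m 1\<^sub>m n - (ratfun_mat A + R)) *
    (1 - coronal (ratfun_mat B) ratfun_x * coronal (ratfun_mat A + R) ratfun_x)"
proof -
  define X where "X = ratfun_x \<cdot>\<^sub>m 1\<^sub>m n - ratfun_mat A"
  define V where "V = ratfun_x \<cdot>\<^sub>m 1\<^sub>m m - ratfun_mat B"
  define P' where "P' = ratfun_x \<cdot>\<^sub>m 1\<^sub>m n - ratfun_mat P"
  define E' where "E' = ratfun_mat E"
  have X: "X \<in> carrier_mat n n" and V: "V \<in> carrier_mat m m"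
    and P': "P' \<in> carrier_mat n n" and E': "E' \<in> carrier_mat n n"
    using A B P E by (auto simp: X_def V_def P'_def E'_def)
  have detP: "det P' \<noteq> 0" unfolding P'_def by (rule det_ratfun_char_nonzero[OF P])
  have detV: "det V \<noteq> 0" unfolding V_def by (rule det_ratfun_char_nonzero[OF B])
  have R: "R \<in> carrier_mat n n"
    using mat_inv[OF P' detP] E unfolding R_def P'_def by auto
  have S: "X - E' * mat_inv P' * E' = ratfun_x \<cdot>\<^sub>m 1\<^sub>m n - (ratfun_mat A + R)"
    using R A unfolding X_def E'_def P'_def R_def[symmetric] by (intro eq_matI) auto
  \<comment> \<open>Since \<open>R\<close> may depend on \<open>x\<close>,
    \<open>det_ratfun_char_nonzero\<close> does not apply directly. It does apply to the real matrix
    \<open>four_block_mat A E E P\<close>, whose characteristic matrix has this Schur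
    complement.\<close>
  have detS: "det (X - E' * mat_inv P' * E') \<noteq> 0"
  proof
    assume "det (X - E' * mat_inv P' * E') = 0"
    moreover have "- E' * mat_inv P' * - E' = E' * mat_inv P' * E'"
      using E' mat_inv[OF P' detP] by simp
    ultimately have "det (four_block_mat X (- E') (- E') P') = 0"
      using det_four_block_mat_schur_lower[OF X _ _ P' detP, of "- E'" "- E'"] E' by simp
    moreover have "four_block_mat X (- E') (- E') P' =
        ratfun_x \<cdot>\<^sub>m 1\<^sub>m (n + n) - ratfun_mat (four_block_mat A E E P)"
      using A E P by (intro eq_matI) (auto simp: X_def E'_def P'_def)
    ultimately show False
      using det_ratfun_char_nonzero[of "four_block_mat A E E P" "n + n"] A P by simp
  qed
  let ?M = "four_block_mat (four_block_mat A (ones_mat n m) (ones_mat m n) B)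
      (pad_rows m E) (pad_cols m E) P"
  have "ratfun_x \<cdot>\<^sub>m 1\<^sub>m (n + m + n) - ratfun_mat ?M =
      four_block_mat (four_block_mat X (- ones_mat n m) (- ones_mat m n) V)
      (pad_rows m (- E')) (pad_cols m (- E')) P'"
    using A B E P
    by (intro eq_matI)
       (auto simp: X_def V_def E'_def P'_def pad_rows_def pad_cols_def const_ratfun.hom_one)
  moreover have "?M \<in> carrier_mat (n + m + n) (n + m + n)" using A B P by simp
  ultimately have "to_fract (char_poly ?M) =
      det (four_block_mat (four_block_mat X (- ones_mat n m) (- ones_mat m n) V)
      (pad_rows m (- E')) (pad_cols m (- E')) P')"
    using det_ratfun_char by metis
  also note det_block_ones[OF X V E' P' detP detV detS]
  finally show ?thesis
    using A B R detS detV unfolding S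
    by (simp add: coronal_eq_ones_mat[of _ n] coronal_eq_ones_mat[of _ m] V_def P'_def)
qed

section \<open>Independence of the vertex order\<close>

text \<open>Rows and columns each contribute the sign of \<open>p\<close>, and the square of a sign
  is 1. The column permutation is treated as a row permutation of the transpose.\<close>

lemma det_permute_rows_cols:
  fixes A :: "'a :: idom mat"
  assumes A: "A \<in> carrier_mat n n" and p: "p permutes {0..<n}"
  shows "det (mat n n (\<lambda>(i, j). A $$ (p i, p j))) = det A"
proof -
  define B where "B = mat n n (\<lambda>(i, j). A $$ (p i, j))"
  define C where "C = mat n n (\<lambda>(i, j). A $$ (p i, p j))"
  have p_less: "p i < n" if "i < n" for i
    using permutes_in_image[OF p, of i] that by simp
  have B: "B \<in> carrier_mat n n" and C: "C \<in> carrier_mat n n" by (auto simp: B_def C_def)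
  have "det C = det (transpose_mat C)" using det_transpose[OF C] by simp
  also have "transpose_mat C = mat n n (\<lambda>(i, j). transpose_mat B $$ (p i, j))"
    by (intro eq_matI) (auto simp: B_def C_def p_less)
  also have "det \<dots> = signof p * det B"
    using B det_transpose[OF B] by (subst det_permute_rows[OF _ p]) auto
  also have "det B = signof p * det A"
    unfolding B_def by (rule det_permute_rows[OF A p])
  finally show ?thesis
    by (simp add: C_def sign_def)
qed

lemma signless_laplacian_carrier [simp]:
  "signless_laplacian G us \<in> carrier_mat (length us) (length us)"
  and adjacency_mat_carrier [simp]: "adjacency_mat G us \<in> carrier_mat (length us) (length us)"
  and deg_mat_carrier [simp]: "deg_mat G us \<in> carrier_mat (length us) (length us)"
  by (auto simp: signless_laplacian_def adjacency_mat_def deg_mat_def)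

lemma signless_laplacian_index:
  assumes "i < length us" and "j < length us"
  shows "signless_laplacian G us $$ (i, j) =
    (if i = j then real (out_degree (with_proj G) (us ! i)) else 0) +
    (if (us ! i, us ! j) \<in> parcs G then 1 else 0)"
  using assms by (simp add: signless_laplacian_def adjacency_mat_def deg_mat_def)

text \<open>Two enumerations differ by a permutation, which acts on rows and columns simultaneously.
  Thus an arbitrary order may be exchanged for the one giving the block form.\<close>

lemma char_poly_signless_laplacian_enum:
  assumes "vertex_enum G us" and "vertex_enum G ws"
  shows "char_poly (signless_laplacian G us) = char_poly (signless_laplacian G ws)"
proof -
  have "mset us = mset ws"
    using assms set_eq_iff_mset_eq_distinct[of us ws] by (auto simp: vertex_enum_def)
  then obtain p where p: "p permutes {..<length ws}" and us: "permute_list p ws = us"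
    by (rule mset_eq_permutation)
  define n where "n = length ws"
  have len: "length us = n" using us by (auto simp: n_def)
  have p': "p permutes {0..<n}" using p by (simp add: n_def atLeast0LessThan)
  have p_less: "p i < n" if "i < n" for i
    using permutes_in_image[OF p', of i] that by simp
  have nth: "us ! i = ws ! p i" if "i < n" for i
    using permute_list_nth[OF p] that us n_def by auto
  have inj: "p i = p j \<longleftrightarrow> i = j" for i j
    using permutes_inj[OF p'] by (auto dest: injD)
  let ?C = "char_poly_matrix (signless_laplacian G ws)"
  have C: "?C \<in> carrier_mat n n" using signless_laplacian_carrier[of G ws] by (simp add: n_def)
  have "char_poly_matrix (signless_laplacian G us) = mat n n (\<lambda>(i, j). ?C $$ (p i, p j))"
    using signless_laplacian_carrier[of G us] signless_laplacian_carrier[of G ws] len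
    by (intro eq_matI)
       (auto simp: char_poly_matrix_def signless_laplacian_index nth p_less inj n_def[symmetric])
  then show ?thesis
    unfolding char_poly_def by (simp add: det_permute_rows_cols[OF C p'])
qed

section \<open>Splitting joins\<close>

text \<open>Taking \<open>H\<close> to be \<open>G1\<close> or its complement yields the NS and the NNS join.\<close>

definition splitting_join ::
  "'v pair_pre_digraph \<Rightarrow> 'v pair_pre_digraph \<Rightarrow> 'v pair_pre_digraph \<Rightarrow> ('v + 'v) pair_pre_digraph"
  where
  "splitting_join G1 G2 H = \<lparr>pverts = Inl ` (pverts G1 \<union> pverts G2) \<union> Inr ` pverts G1,
     parcs = {(Inl v, Inl w) | v w. (v, w) \<in> parcs (graph_join G1 G2)}
       \<union> {(Inr u, Inl w) | u w. (u, w) \<in> parcs H}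
       \<union> {(Inl w, Inr u) | u w. (u, w) \<in> parcs H}\<rparr>"

lemma ns_join_eq_splitting_join:
  assumes "pair_graph G1"
  shows "ns_join G1 G2 = splitting_join G1 G2 G1"
  using pair_graphD(2)[OF assms]
  by (auto simp: ns_join_def splitting_join_def graph_join_def)

lemma nns_join_eq_splitting_join: "nns_join G1 G2 = splitting_join G1 G2 (complement G1)"
  by (auto simp: nns_join_def splitting_join_def graph_join_def complement_def)

section \<open>Degrees as neighbour counts, and degrees in the complement\<close>

lemma out_degree_with_proj: "out_degree (with_proj G) v = card {w. (v, w) \<in> parcs G}"
proof -
  have "out_arcs (with_proj G) v = Pair v ` {w. (v, w) \<in> parcs G}"
    by (auto simp: out_arcs_def)
  then show ?thesis by (simp add: out_degree_def card_image inj_on_def)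
qed

text \<open>The vertex set splits into the vertex itself, its neighbours and its non-neighbours; the
  vertex itself accounts for the \<open>- 1\<close>.\<close>

lemma deg_mat_complement:
  assumes G: "pair_graph G" and us: "vertex_enum G us"
  shows "deg_mat (complement G) us =
    (of_nat (length us) - 1) \<cdot>\<^sub>m 1\<^sub>m (length us) - deg_mat G us"
proof -
  note G' = pair_graphD[OF G]
  have card: "card (pverts G) = length us"
    using us distinct_card[of us] by (auto simp: vertex_enum_def)
  have deg: "real (out_degree (with_proj (complement G)) u) =
      real (length us) - 1 - real (out_degree (with_proj G) u)" if u: "u \<in> pverts G" for u
  proof -
    let ?N = "{w. (u, w) \<in> parcs G}" and ?N' = "{w. (u, w) \<in> parcs (complement G)}"
    have sub: "?N \<subseteq> pverts G" "?N' \<subseteq> pverts G"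
      using G'(2) by (auto simp: complement_def)
    have fin: "finite ?N" "finite ?N'" using sub G'(1) finite_subset by blast+
    have "u \<notin> ?N \<union> ?N'" "?N \<inter> ?N' = {}" "pverts G = insert u (?N \<union> ?N')"
      using u G'(2,4) by (auto simp: complement_def irrefl_def)
    then have "length us = Suc (card ?N + card ?N')"
      using fin card by (simp add: card_Un_disjoint)
    then show ?thesis by (simp add: out_degree_with_proj)
  qed
  have "us ! i \<in> pverts G" if "i < length us" for i
    using that us nth_mem[of i us] unfolding vertex_enum_def by simp
  then show ?thesis
    by (intro eq_matI) (auto simp: deg_mat_def deg)
qed

section \<open>Degrees, block form and characteristic polynomial of a general splitting join\<close>

locale splitting =
  fixes G1 G2 H :: "'v pair_pre_digraph" and us vs :: "'v list" and n m :: nat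
  assumes G1: "pair_graph G1" and G2: "pair_graph G2" and H: "pair_graph H"
    and verts_H: "pverts H = pverts G1" and disjoint: "pverts G1 \<inter> pverts G2 = {}"
    and us: "vertex_enum G1 us" and vs: "vertex_enum G2 vs"
    and n: "length us = n" and m: "length vs = m"
begin

abbreviation "J \<equiv> splitting_join G1 G2 H"

abbreviation "zs \<equiv> map Inl (us @ vs) @ map Inr us"

lemma fin: "finite (pverts G1)" "finite (pverts G2)"
  "finite {w. (u, w) \<in> parcs G1}" "finite {w. (u, w) \<in> parcs G2}" "finite {w. (u, w) \<in> parcs H}"
proof -
  show f: "finite (pverts G1)" "finite (pverts G2)"
    using pair_graphD(1) G1 G2 by blast+
  show "finite {w. (u, w) \<in> parcs G1}" "finite {w. (u, w) \<in> parcs G2}"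
    "finite {w. (u, w) \<in> parcs H}"
    using pair_graphD(2)[OF G1] pair_graphD(2)[OF G2] pair_graphD(2)[OF H] verts_H f
    by (auto intro: finite_subset[of _ "pverts G1"] finite_subset[of _ "pverts G2"])
qed

lemma card_verts: "card (pverts G1) = n" "card (pverts G2) = m"
  using us vs n m distinct_card[of us] distinct_card[of vs] by (auto simp: vertex_enum_def)

lemma vertex_enum_zs: "vertex_enum J zs"
  using us vs disjoint
  by (auto simp: vertex_enum_def splitting_join_def distinct_map inj_on_def)

text \<open>The three summands count the neighbours in \<open>G1\<close>, in \<open>G2\<close> and
  among the copies. Symmetry of \<open>H\<close> turns the copies adjacent to \<open>u\<close> into
  the \<open>H\<close>-neighbours of \<open>u\<close>.\<close>

lemma out_degree_J_left:
  assumes u: "u \<in> pverts G1"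
  shows "out_degree (with_proj J) (Inl u) =
    out_degree (with_proj G1) u + m + out_degree (with_proj H) u"
proof -
  let ?N = "{w. (u, w) \<in> parcs G1}" and ?NH = "{w. (u, w) \<in> parcs H}"
  have disj: "u \<notin> pverts G2" "?N \<inter> pverts G2 = {}"
    using u disjoint pair_graphD(2)[OF G1] by auto
  have "{w. (Inl u, w) \<in> parcs J} = Inl ` (?N \<union> pverts G2) \<union> Inr ` ?NH"
    using u disj(1) pair_graphD(2)[OF G2] pair_graphD(3)[OF H]
    by (auto simp: splitting_join_def graph_join_def sym_def)
  \<comment> \<open>\<open>card_Plus\<close> counts the disjoint union of an \<open>Inl\<close>
    image and an \<open>Inr\<close> image.\<close>
  then show ?thesis
    using disj(2) fin card_verts
    by (simp add: out_degree_with_proj card_Un_disjoint card_image inj_on_def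
        card_Plus[unfolded Plus_def] )
qed

lemma out_degree_J_right:
  assumes v: "v \<in> pverts G2"
  shows "out_degree (with_proj J) (Inl v) = out_degree (with_proj G2) v + n"
proof -
  let ?N = "{w. (v, w) \<in> parcs G2}"
  have disj: "v \<notin> pverts G1" "?N \<inter> pverts G1 = {}"
    using v disjoint pair_graphD(2)[OF G2] by auto
  have "{w. (Inl v, w) \<in> parcs J} = Inl ` (?N \<union> pverts G1)"
    using v disj(1) pair_graphD(2)[OF G1] pair_graphD(2)[OF H] verts_H
    by (auto simp: splitting_join_def graph_join_def)
  then show ?thesis
    using disj(2) fin card_verts
    by (simp add: out_degree_with_proj card_Un_disjoint card_image inj_on_def)
qed

lemma out_degree_J_copy: "out_degree (with_proj J) (Inr u) = out_degree (with_proj H) u"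
proof -
  have "{w. (Inr u, w) \<in> parcs J} = Inl ` {w. (u, w) \<in> parcs H}"
    by (auto simp: splitting_join_def)
  then show ?thesis
    by (simp add: out_degree_with_proj card_image)
qed

text \<open>The diagonal shifts come from the degrees: a vertex of \<open>G1\<close> gains
  \<open>m\<close> from the join and its \<open>H\<close>-degree from the copies, a vertex of
  \<open>G2\<close> gains \<open>n\<close>. The entries are compared block by block.\<close>

lemma signless_laplacian_J:
  "signless_laplacian J zs = four_block_mat
    (four_block_mat (of_nat m \<cdot>\<^sub>m 1\<^sub>m n + signless_laplacian G1 us + deg_mat H us)
      (ones_mat n m) (ones_mat m n) (of_nat n \<cdot>\<^sub>m 1\<^sub>m m + signless_laplacian G2 vs))
    (pad_rows m (adjacency_mat H us)) (pad_cols m (adjacency_mat H us)) (deg_mat H us)"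
  (is "_ = ?R")
proof (rule eq_matI)
  show "dim_row (signless_laplacian J zs) = dim_row ?R" "dim_col (signless_laplacian J zs) = dim_col ?R"
    by (auto simp: signless_laplacian_def adjacency_mat_def deg_mat_def n m)
  fix i j assume "i < dim_row ?R" "j < dim_col ?R"
  then have ij: "i < n + m + n" "j < n + m + n"
    by (auto simp: deg_mat_def signless_laplacian_def adjacency_mat_def n m)
  have us_in: "us ! k \<in> pverts G1" if "k < n" for k
    using that us n nth_mem[of k us] unfolding vertex_enum_def by simp
  have vs_in: "vs ! k \<in> pverts G2" if "k < m" for k
    using that vs m nth_mem[of k vs] unfolding vertex_enum_def by simp
  have arcs1: "(u, w) \<in> parcs G1 \<Longrightarrow> u \<in> pverts G1 \<and> w \<in> pverts G1" for u w
    using pair_graphD(2)[OF G1] by auto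
  have arcs2: "(u, w) \<in> parcs G2 \<Longrightarrow> u \<in> pverts G2 \<and> w \<in> pverts G2" for u w
    using pair_graphD(2)[OF G2] by auto
  have arcsH: "(u, w) \<in> parcs H \<Longrightarrow> u \<in> pverts G1 \<and> w \<in> pverts G1" for u w
    using pair_graphD(2)[OF H] verts_H by auto
  have symH: "(u, w) \<in> parcs H \<longleftrightarrow> (w, u) \<in> parcs H" for u w
    using pair_graphD(3)[OF H] by (auto simp: sym_def)
  have disj: "u \<in> pverts G1 \<Longrightarrow> u \<notin> pverts G2" for u using disjoint by auto
  have arcs_J: "(Inl u, Inl w) \<in> parcs J \<longleftrightarrow> (u, w) \<in> parcs (graph_join G1 G2)"
    "(Inr u, Inl w) \<in> parcs J \<longleftrightarrow> (u, w) \<in> parcs H"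
    "(Inl u, Inr w) \<in> parcs J \<longleftrightarrow> (u, w) \<in> parcs H"
    "(Inr u, Inr w) \<notin> parcs J" for u w
    using symH by (auto simp: splitting_join_def)
  have arcs_join: "(u, w) \<in> parcs (graph_join G1 G2) \<longleftrightarrow> (u, w) \<in> parcs G1"
    if "u \<in> pverts G1" "w \<in> pverts G1" for u w
    using that disj arcs2 by (auto simp: graph_join_def)
  have arcs_join': "(u, w) \<in> parcs (graph_join G1 G2) \<longleftrightarrow> (u, w) \<in> parcs G2"
    if "u \<in> pverts G2" "w \<in> pverts G2" for u w
    using that disj arcs1 by (auto simp: graph_join_def)
  have arcs_join'': "(u, w) \<in> parcs (graph_join G1 G2)" "(w, u) \<in> parcs (graph_join G1 G2)"
    if "u \<in> pverts G1" "w \<in> pverts G2" for u w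
    using that by (auto simp: graph_join_def)
  have noH: "(u, w) \<notin> parcs H" "(w, u) \<notin> parcs H" if "w \<in> pverts G2" for u w
    using that arcsH disj by auto
  \<comment> \<open>Naming the list hides its append structure, so that lookups go only through
    \<open>xs1\<close>, \<open>xs2\<close> and \<open>xs3\<close>.\<close>
  define xs where "xs = zs"
  have len: "length xs = n + m + n" by (simp add: xs_def n m)
  have xs1: "xs ! k = Inl (us ! k)" if "k < n" for k
    using that by (simp add: xs_def nth_append n)
  have xs2: "xs ! k = Inl (vs ! (k - n))" if "k < n + m" "\<not> k < n" for k
    using that by (simp add: xs_def nth_append n m)
  have xs3: "xs ! k = Inr (us ! (k - (n + m)))" if "k < n + m + n" "\<not> k < n + m" for k
    using that by (simp add: xs_def nth_append n m)
  note entry = signless_laplacian_index[of _ xs _ J, unfolded len]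
  have dims: "dim_row (deg_mat K us) = n" "dim_col (deg_mat K us) = n"
    "dim_row (adjacency_mat K us) = n" "dim_col (adjacency_mat K us) = n"
    "dim_row (signless_laplacian K us) = n" "dim_col (signless_laplacian K us) = n"
    "dim_row (signless_laplacian K vs) = m" "dim_col (signless_laplacian K vs) = m" for K
    by (auto simp: signless_laplacian_def adjacency_mat_def deg_mat_def n m)
  consider (1) "i < n" | (2) "\<not> i < n" "i < n + m" | (3) "\<not> i < n + m" by linarith
  then have "signless_laplacian J xs $$ (i, j) = ?R $$ (i, j)"
  proof cases
    case 1
    consider (1) "j < n" | (2) "\<not> j < n" "j < n + m" | (3) "\<not> j < n + m" by linarith
    then show ?thesis
    proof cases
      case j: 1
      show ?thesis
        using 1 j ij us_in
        by (simp add: entry xs1 arcs_J arcs_join out_degree_J_left signless_laplacian_index n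
            dims deg_mat_def)
    next
      case j: 2
      show ?thesis
        using 1 j ij us_in[of i] vs_in[of "j - n"]
        by (simp add: entry xs1 xs2 arcs_J arcs_join'' dims)
    next
      case j: 3
      show ?thesis
        using 1 j ij
        by (simp add: entry xs1 xs3 arcs_J dims pad_rows_def adjacency_mat_def n)
    qed
  next
    case 2
    consider (1) "j < n" | (2) "\<not> j < n" "j < n + m" | (3) "\<not> j < n + m" by linarith
    then show ?thesis
    proof cases
      case j: 1
      show ?thesis
        using 2 j ij us_in[of j] vs_in[of "i - n"]
        by (simp add: entry xs1 xs2 arcs_J arcs_join'' dims)
    next
      case j: 2
      \<comment> \<open>Both indices are at least \<open>n\<close>, so truncated subtraction is
        injective here and diagonal entries match diagonal entries.\<close>
      have "i - n = j - n \<longleftrightarrow> i = j" using 2 j by linarith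
      then show ?thesis
        using 2 j ij vs_in[of "i - n"] vs_in[of "j - n"]
        by (simp add: entry xs2 arcs_J arcs_join' out_degree_J_right signless_laplacian_index m dims)
    next
      case j: 3
      show ?thesis
        using 2 j ij vs_in[of "i - n"]
        by (simp add: entry xs2 xs3 arcs_J noH dims pad_rows_def)
    qed
  next
    case 3
    consider (1) "j < n" | (2) "\<not> j < n" "j < n + m" | (3) "\<not> j < n + m" by linarith
    then show ?thesis
    proof cases
      case j: 1
      show ?thesis
        using 3 j ij
        by (simp add: entry xs1 xs3 arcs_J dims pad_cols_def adjacency_mat_def n)
    next
      case j: 2
      show ?thesis
        using 3 j ij vs_in[of "j - n"]
        by (simp add: entry xs2 xs3 arcs_J noH dims pad_cols_def)
    next
      case j: 3
      have "i - (n + m) = j - (n + m) \<longleftrightarrow> i = j" using 3 j by linarith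
      then show ?thesis
        using 3 j ij
        by (simp add: entry xs3 arcs_J out_degree_J_copy dims deg_mat_def n)
    qed
  qed
  then show "signless_laplacian J zs $$ (i, j) = ?R $$ (i, j)" by (simp only: xs_def)
qed

text \<open>The scalar shifts \<open>m\<close> and \<open>n\<close> of the diagonal blocks are
  absorbed into the variable. The dimensions of \<open>R\<close> are exported because later
  rewriting treats \<open>R\<close> as opaque.\<close>

lemma char_poly_splitting_join:
  assumes ws: "vertex_enum J ws"
  defines "x \<equiv> ratfun_x" and "D \<equiv> ratfun_mat (deg_mat H us)"
    and "Q1 \<equiv> ratfun_mat (signless_laplacian G1 us)"
    and "Q2 \<equiv> ratfun_mat (signless_laplacian G2 vs)"
  defines "R \<equiv> ratfun_mat (adjacency_mat H us) * mat_inv (x \<cdot>\<^sub>m 1\<^sub>m n - D)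
    * ratfun_mat (adjacency_mat H us)"
  shows "to_fract (char_poly (signless_laplacian J ws)) =
      det ((x - of_nat n) \<cdot>\<^sub>m 1\<^sub>m m - Q2) * det (x \<cdot>\<^sub>m 1\<^sub>m n - D)
      * det ((x - of_nat m) \<cdot>\<^sub>m 1\<^sub>m n - Q1 - D - R)
      * (1 - coronal Q2 (x - of_nat n) * coronal (Q1 + D + R) (x - of_nat m))"
    and "R \<in> carrier_mat n n"
proof -
  have const: "to_fract [:real k:] = of_nat k" for k
    using const_ratfun.hom_of_nat[of k] by simp
  define A where "A = of_nat m \<cdot>\<^sub>m 1\<^sub>m n + signless_laplacian G1 us + deg_mat H us"
  define B where "B = of_nat n \<cdot>\<^sub>m 1\<^sub>m m + signless_laplacian G2 vs"
  have c: "signless_laplacian G1 us \<in> carrier_mat n n" "deg_mat H us \<in> carrier_mat n n"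
    "adjacency_mat H us \<in> carrier_mat n n" "signless_laplacian G2 vs \<in> carrier_mat m m"
    by (simp_all flip: n m)
  have carrier: "A \<in> carrier_mat n n" "B \<in> carrier_mat m m" "Q1 \<in> carrier_mat n n"
    "Q2 \<in> carrier_mat m m" "D \<in> carrier_mat n n"
    using c by (auto simp: A_def B_def Q1_def Q2_def D_def)
  have "mat_inv (x \<cdot>\<^sub>m 1\<^sub>m n - D) \<in> carrier_mat n n"
    unfolding x_def D_def
    by (rule mat_inv(3)[OF _ det_ratfun_char_nonzero[OF c(2)]]) (use c in auto)
  then show R: "R \<in> carrier_mat n n" using c by (auto simp: R_def)
  have "to_fract (char_poly (signless_laplacian J ws)) = to_fract (char_poly (signless_laplacian J zs))"
    using char_poly_signless_laplacian_enum[OF ws vertex_enum_zs] by simp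
  also have "\<dots> = det (x \<cdot>\<^sub>m 1\<^sub>m m - ratfun_mat B) * det (x \<cdot>\<^sub>m 1\<^sub>m n - D) *
    det (x \<cdot>\<^sub>m 1\<^sub>m n - (ratfun_mat A + R)) *
    (1 - coronal (ratfun_mat B) x * coronal (ratfun_mat A + R) x)"
    unfolding signless_laplacian_J x_def R_def D_def
    using char_poly_block_ones[of A n B m "adjacency_mat H us" "deg_mat H us"] carrier c
    by (simp add: A_def B_def)
  also have B: "x \<cdot>\<^sub>m 1\<^sub>m m - ratfun_mat B = (x - of_nat n) \<cdot>\<^sub>m 1\<^sub>m m - Q2"
    using c by (intro eq_matI) (auto simp: B_def Q2_def const_ratfun.hom_add const)
  also have A: "x \<cdot>\<^sub>m 1\<^sub>m n - (ratfun_mat A + R) = (x - of_nat m) \<cdot>\<^sub>m 1\<^sub>m n - Q1 - D - R"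
    using c R
    by (intro eq_matI) (auto simp: A_def Q1_def D_def const_ratfun.hom_add const algebra_simps)
  also have "coronal (ratfun_mat B) x = coronal Q2 (x - of_nat n)"
    using carrier B by (intro coronal_cong) auto
  \<comment> \<open>This equation only feeds the coronal identity after it, which is the actual next
    link of the chain; the determinant keeps its subtracted form.\<close>
  also have "(x - of_nat m) \<cdot>\<^sub>m 1\<^sub>m n - Q1 - D - R = (x - of_nat m) \<cdot>\<^sub>m 1\<^sub>m n - (Q1 + D + R)"
    using carrier R by (intro eq_matI) auto
  then have "coronal (ratfun_mat A + R) x = coronal (Q1 + D + R) (x - of_nat m)"
    using carrier R A by (intro coronal_cong[of _ n]) auto
  finally show "to_fract (char_poly (signless_laplacian J ws)) =
      det ((x - of_nat n) \<cdot>\<^sub>m 1\<^sub>m m - Q2) * det (x \<cdot>\<^sub>m 1\<^sub>m n - D)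
      * det ((x - of_nat m) \<cdot>\<^sub>m 1\<^sub>m n - Q1 - D - R)
      * (1 - coronal Q2 (x - of_nat n) * coronal (Q1 + D + R) (x - of_nat m))" .
qed

end

text \<open>Part (b) is the general formula with \<open>H\<close> equal to \<open>G1\<close>. Part
  (a) takes the complement for \<open>H\<close> and then expresses the degrees of the complement
  through those of \<open>G1\<close>.\<close>

theorem theorem4p3:
  fixes G1 G2 :: "'v pair_pre_digraph"
    and us vs :: "'v list"
    and ws ws' :: "('v + 'v) list"
    and n1 n2 :: nat
  assumes "pair_graph G1" and "pair_graph G2"
    and "pverts G1 \<inter> pverts G2 = {}"
    and "card (pverts G1) = n1" and "card (pverts G2) = n2"
    and "vertex_enum G1 us" and "vertex_enum G2 vs"
    and "vertex_enum (nns_join G1 G2) ws" and "vertex_enum (ns_join G1 G2) ws'"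
  shows
    "let x = ratfun_x;
         N1 = of_nat n1;
         N2 = of_nat n2;
         I1 = 1\<^sub>m n1;
         I2 = 1\<^sub>m n2;
         A1 = ratfun_mat (adjacency_mat G1 us);
         Ac1 = ratfun_mat (adjacency_mat (complement G1) us);
         D1 = ratfun_mat (deg_mat G1 us);
         Q1 = ratfun_mat (signless_laplacian G1 us);
         Q2 = ratfun_mat (signless_laplacian G2 vs)
     in
       to_fract (char_poly (signless_laplacian (nns_join G1 G2) ws)) =
         det ((x - N1) \<cdot>\<^sub>m I2 - Q2)
         * det ((x - N1 + 1) \<cdot>\<^sub>m I1 + D1)
         * det ((x - N1 - N2 + 1) \<cdot>\<^sub>m I1 - Q1 + D1
                - Ac1 * mat_inv ((x - N1 + 1) \<cdot>\<^sub>m I1 + D1) * Ac1)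
         * (1 - coronal Q2 (x - N1)
                * coronal (Q1 - D1 + Ac1 * mat_inv ((x - N1 + 1) \<cdot>\<^sub>m I1 + D1) * Ac1)
                    (x - N1 - N2 + 1))
       \<and>
       to_fract (char_poly (signless_laplacian (ns_join G1 G2) ws')) =
         det ((x - N1) \<cdot>\<^sub>m I2 - Q2)
         * det (x \<cdot>\<^sub>m I1 - D1)
         * det ((x - N2) \<cdot>\<^sub>m I1 - Q1 - D1
                - A1 * mat_inv (x \<cdot>\<^sub>m I1 - D1) * A1)
         * (1 - coronal Q2 (x - N1)
                * coronal (Q1 + D1 + A1 * mat_inv (x \<cdot>\<^sub>m I1 - D1) * A1) (x - N2))"
proof -
  have len: "length us = n1" "length vs = n2"
    using assms(4-7) distinct_card[of us] distinct_card[of vs] by (auto simp: vertex_enum_def)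
  interpret ns: splitting G1 G2 G1 us vs n1 n2
    using assms len by (simp add: splitting_def)
  interpret nns: splitting G1 G2 "complement G1" us vs n1 n2
    using assms len pair_graph_complement[OF assms(1)]
    by (simp add: splitting_def complement_def)
  define x where "x = ratfun_x"
  define A where "A = ratfun_mat (adjacency_mat (complement G1) us)"
  define D where "D = ratfun_mat (deg_mat G1 us)"
  define Dc where "Dc = ratfun_mat (deg_mat (complement G1) us)"
  define Q where "Q = ratfun_mat (signless_laplacian G1 us)"
  define R where "R = A * mat_inv (x \<cdot>\<^sub>m 1\<^sub>m n1 - Dc) * A"
  note nns = nns.char_poly_splitting_join[of ws, folded nns_join_eq_splitting_join, OF assms(8),
      folded x_def A_def D_def Dc_def Q_def, folded R_def]
  have "deg_mat G1 us \<in> carrier_mat n1 n1" "signless_laplacian G1 us \<in> carrier_mat n1 n1"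
    by (simp_all flip: len)
  then have carrier: "deg_mat G1 us \<in> carrier_mat n1 n1" "D \<in> carrier_mat n1 n1"
    "Q \<in> carrier_mat n1 n1"
    by (auto simp: D_def Q_def)
  have "to_fract [:real n1:] = of_nat n1"
    using const_ratfun.hom_of_nat[of n1] by simp
  then have Dc: "Dc = (of_nat n1 - 1) \<cdot>\<^sub>m 1\<^sub>m n1 - D"
    using carrier
    by (intro eq_matI)
       (auto simp: Dc_def D_def deg_mat_complement[OF assms(1,6)] len const_ratfun.hom_minus
         const_ratfun.hom_one)
  \<comment> \<open>Subtracting \<open>of_nat n1 - 1\<close> from \<open>x\<close> is the source of
    every \<open>+ 1\<close> in part (a).\<close>
  have inv: "x \<cdot>\<^sub>m 1\<^sub>m n1 - Dc = (x - of_nat n1 + 1) \<cdot>\<^sub>m 1\<^sub>m n1 + D"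
    using carrier by (intro eq_matI) (auto simp: Dc)
  have det: "(x - of_nat n2) \<cdot>\<^sub>m 1\<^sub>m n1 - Q - Dc - R =
      (x - of_nat n1 - of_nat n2 + 1) \<cdot>\<^sub>m 1\<^sub>m n1 - Q + D - R"
    using carrier nns(2) by (intro eq_matI) (auto simp: Dc algebra_simps)
  have cor: "coronal (Q + Dc + R) (x - of_nat n2) =
      coronal (Q - D + R) (x - of_nat n1 - of_nat n2 + 1)"
    using carrier nns(2)
    by (intro coronal_cong[of _ n1]) (auto simp: Dc intro!: eq_matI)
  \<comment> \<open>\<open>det\<close> and \<open>cor\<close> are stated for the folded
    \<open>R\<close>, so they are applied before \<open>R_def\<close>; \<open>inv\<close> then
    rewrites both the determinant factor and the inverse inside \<open>R\<close>.\<close>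
  show ?thesis
    using nns(1) ns.char_poly_splitting_join(1)[of ws', folded ns_join_eq_splitting_join[OF assms(1)],
        OF assms(9)]
    unfolding det cor unfolding R_def inv
    by (simp add: Let_def x_def A_def D_def Q_def)
qed

end
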